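(* Let $m=2r$ and $n=2s$ for some positive integers $r,s$. Then $\gamma_I(C_m \square C_n) = \frac{mn}{2}$.
   Context: For an integer $k\ge 2$, $C_k$ denotes the directed cycle with vertex set $\{1,2,\dots,k\}$ and arcs $i\rightarrow i+1$ (indices taken modulo $k$). For digraphs $D_1=(V_1,A_1)$ and $D_2=(V_2,A_2)$, the cartesian product $D_1\square D_2$ is the digraph with vertex set $V_1\times V_2$ in which $(x_1,x_2)\rightarrow(y_1,y_2)$ is an arc if and only if either ($x_1=y_1$ and $x_2\rightarrow y_2$ in $D_2$) or ($x_1\rightarrow y_1$ in $D_1$ and $x_2=y_2$). An Italian dominating function on a digraph $D$ is a function $f:V(D)\to\{0,1,2\}$ such that every vertex $v$ with $f(v)=0$ has at least two in-neighbors $u$ with $f(u)=1$ or at least one in-neighbor $w$ with $f(w)=2$ (an in-neighbor of $v$ is a vertex $u$ with $u\rightarrow v$). Its weight is $\sum_{u\in V(D)} f(u)$, and the Italian domination number $\gamma_I(D)$ is the minimum weight of an Italian dominating function on $D$. *)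

theory Defs
  imports Complex_Main "HOL-Library.FuncSet" "Graph_Theory.Pair_Digraph"
begin

text \<open>The successor of \<open>i\<close> modulo \<open>k\<close> within the representatives \<open>{1..k}\<close> is \<open>i mod k + 1\<close>.\<close>

definition directed_cycle :: "nat \<Rightarrow> nat pair_pre_digraph" where
  "directed_cycle k =
     \<lparr> pverts = {1..k}, parcs = {(i, j). i \<in> {1..k} \<and> j = i mod k + 1} \<rparr>"

definition cartesian_product ::
  "'a pair_pre_digraph \<Rightarrow> 'b pair_pre_digraph \<Rightarrow> ('a \<times> 'b) pair_pre_digraph" where
  "cartesian_product D1 D2 =
     \<lparr> pverts = pverts D1 \<times> pverts D2,
       parcs = {((x1, x2), (y1, y2)).
         (x1, x2) \<in> pverts D1 \<times> pverts D2 \<and> (y1, y2) \<in> pverts D1 \<times> pverts D2 \<and>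
         (x1 = y1 \<and> (x2, y2) \<in> parcs D2 \<or> (x1, y1) \<in> parcs D1 \<and> x2 = y2)} \<rparr>"

definition in_neighbors :: "'a pair_pre_digraph \<Rightarrow> 'a \<Rightarrow> 'a set" where
  "in_neighbors D v = {u \<in> pverts D. (u, v) \<in> parcs D}"

definition italian_dominating_function :: "'a pair_pre_digraph \<Rightarrow> ('a \<Rightarrow> nat) \<Rightarrow> bool" where
  "italian_dominating_function D f \<longleftrightarrow>
     f \<in> pverts D \<rightarrow> {0, 1, 2} \<and>
     (\<forall>v \<in> pverts D. f v = 0 \<longrightarrow>
        (\<exists>u1 \<in> in_neighbors D v. \<exists>u2 \<in> in_neighbors D v. u1 \<noteq> u2 \<and> f u1 = 1 \<and> f u2 = 1) \<or>
        (\<exists>w \<in> in_neighbors D v. f w = 2))"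

definition weight :: "'a pair_pre_digraph \<Rightarrow> ('a \<Rightarrow> nat) \<Rightarrow> nat" where
  "weight D f = (\<Sum>u \<in> pverts D. f u)"

text \<open>Intended for finite digraphs, as \<open>weight\<close> is \<open>0\<close> on an infinite vertex set.\<close>

definition italian_domination_number :: "'a pair_pre_digraph \<Rightarrow> nat" where
  "italian_domination_number D = (LEAST w. \<exists>f. italian_dominating_function D f \<and> weight D f = w)"

lemma italian_domination_number_attained:
  "\<exists>f. italian_dominating_function D f \<and> weight D f = italian_domination_number D"
  unfolding italian_domination_number_def
proof (rule LeastI_ex)
  have "italian_dominating_function D (\<lambda>_. 2)"
    by (simp add: italian_dominating_function_def)
  then show "\<exists>w f. italian_dominating_function D f \<and> weight D f = w" by blast
qed

lemma italian_domination_number_le: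
  "italian_dominating_function D f \<Longrightarrow> italian_domination_number D \<le> weight D f"
  unfolding italian_domination_number_def by (rule Least_le) blast

lemma pair_digraph_directed_cycle:
  assumes "k \<ge> 2"
  shows "pair_digraph (directed_cycle k)"
proof
  show "finite (parcs (directed_cycle k))"
    by (rule finite_subset[of _ "{1..k} \<times> {1..k}"])
       (use assms in \<open>auto simp: directed_cycle_def Suc_le_eq\<close>)
  show "fst e \<noteq> snd e" if "e \<in> parcs (directed_cycle k)" for e
    using that assms by (cases "fst e = k") (auto simp: directed_cycle_def)
qed (use assms in \<open>auto simp: directed_cycle_def Suc_le_eq\<close>)

lemma pair_digraph_cartesian_product:
  assumes "pair_digraph D1" "pair_digraph D2"
  shows "pair_digraph (cartesian_product D1 D2)"
proof -
  interpret D1: pair_digraph D1 by fact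
  interpret D2: pair_digraph D2 by fact
  have fin: "finite (pverts D1 \<times> pverts D2)"
    using D1.pair_finite_verts D2.pair_finite_verts by simp
  show ?thesis
  proof
    show "finite (parcs (cartesian_product D1 D2))"
      by (rule finite_subset[OF _ finite_cartesian_product[OF fin fin]])
         (auto simp: cartesian_product_def)
    show "fst e \<noteq> snd e" if "e \<in> parcs (cartesian_product D1 D2)" for e
      using that D1.pair_no_loops D2.pair_no_loops by (fastforce simp: cartesian_product_def)
  qed (use fin in \<open>auto simp: cartesian_product_def\<close>)
qed

end

theory Submission
  imports Defs
begin

text \<open>
  If \<open>f\<close> is an Italian dominating function, then \<open>2 f(v)\<close> plus the sum of \<open>f\<close> over the
  in-neighbors of \<open>v\<close> is at least \<open>2\<close> for every vertex \<open>v\<close>. Summing over all \<open>v\<close> counts each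
  value \<open>f(u)\<close> with multiplicity two plus the out-degree of \<open>u\<close>, which is two in a product of
  directed cycles; this gives the lower bound. It is attained by the checkerboard function: on even
  cycles every arc changes the parity of the coordinate sum.
\<close>

text \<open>If \<open>f v\<close> is positive, the term \<open>2 * f v\<close> suffices. Otherwise
  domination supplies two distinct in-neighbors of value 1 or one of value 2, and the remaining
  terms are nonnegative.\<close>

lemma italian_dominating_function_local_bound:
  assumes "italian_dominating_function D f" "finite (pverts D)" "v \<in> pverts D"
  shows "2 \<le> 2 * f v + (\<Sum>u\<in>in_neighbors D v. f u)"
proof (cases "f v = 0")
  case True
  have fin: "finite (in_neighbors D v)"
    using assms(2) by (simp add: in_neighbors_def)
  consider u1 u2 where "u1 \<in> in_neighbors D v" "u2 \<in> in_neighbors D v" "u1 \<noteq> u2"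
      "f u1 = 1" "f u2 = 1"
    | w where "w \<in> in_neighbors D v" "f w = 2"
    using assms(1,3) True unfolding italian_dominating_function_def by blast
  then show ?thesis
  proof cases
    case 1
    then show ?thesis
      using sum_mono2[OF fin, of "{u1, u2}" f] by simp
  next
    case 2
    then show ?thesis
      using member_le_sum[of w "in_neighbors D v" f] fin by simp
  qed
qed simp

lemma italian_dominating_function_weight_ge:
  assumes f: "italian_dominating_function D f" and fin: "finite (pverts D)"
    and outdeg: "\<And>u. u \<in> pverts D \<Longrightarrow> card {v \<in> pverts D. (u, v) \<in> parcs D} \<le> d"
  shows "2 * card (pverts D) \<le> (2 + d) * weight D f"
proof -
  \<comment> \<open>Double counting over arcs: grouped by tail instead of head, \<open>f u\<close>
    occurs once for each out-neighbor of \<open>u\<close>, hence at most \<open>d\<close>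
    times.\<close>
  have "(\<Sum>v\<in>pverts D. \<Sum>u\<in>in_neighbors D v. f u)
      = (\<Sum>u\<in>pverts D. \<Sum>v | v \<in> pverts D \<and> (u, v) \<in> parcs D. f u)"
    unfolding in_neighbors_def by (rule sum.swap_restrict[OF fin fin])
  also have "\<dots> \<le> (\<Sum>u\<in>pverts D. d * f u)"
    using outdeg by (intro sum_mono) simp
  finally have in_sum: "(\<Sum>v\<in>pverts D. \<Sum>u\<in>in_neighbors D v. f u) \<le> d * weight D f"
    by (simp add: weight_def sum_distrib_left)
  have "2 * card (pverts D) = (\<Sum>v\<in>pverts D. 2)"
    by simp
  also have "\<dots> \<le> (\<Sum>v\<in>pverts D. 2 * f v + (\<Sum>u\<in>in_neighbors D v. f u))"
    by (intro sum_mono italian_dominating_function_local_bound[OF f fin])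
  also have "\<dots> = 2 * weight D f + (\<Sum>v\<in>pverts D. \<Sum>u\<in>in_neighbors D v. f u)"
    by (simp add: sum.distrib weight_def sum_distrib_left)
  finally show ?thesis
    using in_sum by (simp add: algebra_simps)
qed

text \<open>An arc advances exactly one coordinate to its cyclic successor. An upper bound is what
  the weight estimate asks for, so the two successors need not be shown distinct.\<close>

lemma cycle_product_outdegree_le:
  "card {v \<in> pverts (cartesian_product (directed_cycle m) (directed_cycle n)).
      (u, v) \<in> parcs (cartesian_product (directed_cycle m) (directed_cycle n))} \<le> 2"
  (is "card ?N \<le> 2")
proof -
  obtain i j where u: "u = (i, j)" by fastforce
  have "?N \<subseteq> {(i mod m + 1, j), (i, j mod n + 1)}"
    by (auto simp: u cartesian_product_def directed_cycle_def)
  then have "card ?N \<le> card {(i mod m + 1, j), (i, j mod n + 1)}"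
    by (intro card_mono) simp_all
  also have "\<dots> \<le> 2"
    by (simp add: card_insert_if)
  finally show ?thesis .
qed

lemma even_cycle_predecessor:
  assumes "even k" "i \<in> {1..k}"
  obtains i' where "(i', i) \<in> parcs (directed_cycle k)" "even i' \<longleftrightarrow> odd i"
proof (cases "i = 1")
  case True
  \<comment> \<open>The wrap-around arc from \<open>k\<close> to 1 changes parity because
    \<open>k\<close> is even.\<close>
  with assms that[of k] show ?thesis by (auto simp: directed_cycle_def)
next
  case False
  have "(i - 1, i) \<in> parcs (directed_cycle k)" "even (i - 1) \<longleftrightarrow> odd i"
    using False assms(2) by (auto simp: directed_cycle_def)
  with that show ?thesis by blast
qed

definition checkerboard :: "nat \<times> nat \<Rightarrow> nat" where
  "checkerboard = (\<lambda>(i, j). of_bool (even (i + j)))"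

lemma italian_dominating_function_checkerboard:
  assumes "even m" "even n"
  shows "italian_dominating_function (cartesian_product (directed_cycle m) (directed_cycle n))
           checkerboard" (is "italian_dominating_function ?D _")
  unfolding italian_dominating_function_def
proof (intro conjI ballI impI disjI1)
  show "checkerboard \<in> pverts ?D \<rightarrow> {0, 1, 2}"
    by (auto simp: checkerboard_def)
next
  fix v assume v: "v \<in> pverts ?D" and zero: "checkerboard v = 0"
  obtain i j where ij: "v = (i, j)" "i \<in> {1..m}" "j \<in> {1..n}"
    using v by (auto simp: cartesian_product_def directed_cycle_def)
  have odd: "odd (i + j)"
    using zero by (simp add: checkerboard_def ij(1))
  obtain i' where i': "(i', i) \<in> parcs (directed_cycle m)" "even i' \<longleftrightarrow> odd i"
    using even_cycle_predecessor[OF assms(1) ij(2)] .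
  obtain j' where j': "(j', j) \<in> parcs (directed_cycle n)" "even j' \<longleftrightarrow> odd j"
    using even_cycle_predecessor[OF assms(2) ij(3)] .
  have "(i', j) \<in> in_neighbors ?D v" "(i, j') \<in> in_neighbors ?D v"
    using i'(1) j'(1) ij
    by (auto simp: in_neighbors_def cartesian_product_def directed_cycle_def)
  \<comment> \<open>\<open>i'\<close> and \<open>i\<close> have opposite parity, so the first
    coordinates differ.\<close>
  moreover have "(i', j) \<noteq> (i, j')"
    using i'(2) by auto
  moreover have "checkerboard (i', j) = 1" "checkerboard (i, j') = 1"
    using odd i'(2) j'(2) by (auto simp: checkerboard_def)
  ultimately show "\<exists>u1\<in>in_neighbors ?D v. \<exists>u2\<in>in_neighbors ?D v.
      u1 \<noteq> u2 \<and> checkerboard u1 = 1 \<and> checkerboard u2 = 1"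
    by blast
qed

text \<open>Each induction step adds two consecutive values of \<open>j\<close>, exactly one of
  which makes \<open>i + j\<close> even, whatever the parity of \<open>i\<close>.\<close>

lemma sum_of_bool_even_add:
  "(\<Sum>j\<in>{1..2 * s}. of_bool (even (i + j)) :: nat) = s"
  by (induction s) auto

lemma weight_checkerboard:
  "weight (cartesian_product (directed_cycle m) (directed_cycle (2 * s))) checkerboard = m * s"
proof -
  have "weight (cartesian_product (directed_cycle m) (directed_cycle (2 * s))) checkerboard
      = (\<Sum>i\<in>{1..m}. \<Sum>j\<in>{1..2 * s}. of_bool (even (i + j)))"
    by (simp only: weight_def cartesian_product_def directed_cycle_def checkerboard_def
        sum.cartesian_product pair_pre_digraph.select_convs)
  also have "\<dots> = m * s"
    by (simp only: sum_of_bool_even_add) simp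
  finally show ?thesis .
qed

theorem theorem2p1:
  fixes m n r s :: nat
  assumes "r > 0" and "s > 0" and "m = 2 * r" and "n = 2 * s"
  shows "real (italian_domination_number (cartesian_product (directed_cycle m) (directed_cycle n)))
           = real m * real n / 2"
proof -
  let ?D = "cartesian_product (directed_cycle m) (directed_cycle n)"
  have verts: "finite (pverts ?D)" "card (pverts ?D) = m * n"
    by (simp_all add: cartesian_product_def directed_cycle_def)
  obtain f where f: "italian_dominating_function ?D f" "weight ?D f = italian_domination_number ?D"
    using italian_domination_number_attained by blast
  \<comment> \<open>The factor 4 is \<open>2 + d\<close> for the out-degree bound
    \<open>d = 2\<close>.\<close>
  have "2 * (m * n) \<le> 4 * italian_domination_number ?D"
    using italian_dominating_function_weight_ge[OF f(1) verts(1) cycle_product_outdegree_le]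
    by (simp add: verts f(2))
  moreover have "italian_domination_number ?D \<le> m * s"
    using italian_domination_number_le[OF italian_dominating_function_checkerboard[of m n]]
      weight_checkerboard[of m s] assms by simp
  \<comment> \<open>Since \<open>n = 2 * s\<close>, the lower bound reads \<open>4 * (m * s)\<close>
    \<le> 4 times the domination number, so both bounds meet.\<close>
  ultimately have "italian_domination_number ?D = m * s"
    by (simp add: assms)
  then show ?thesis
    by (simp add: assms)
qed

end
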